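(* Let $n > 0$ be even. Let $\delta_3(n) = 1$ if $n$ has a prime factor $p > 3$ with $p \equiv 3 \pmod 4$, and $\delta_3(n) = 0$ otherwise. Then $$\mathrm{diam}(G_n) = \begin{cases} 12, & \text{if } n \text{ is a multiple of } 24;\\ 6, & \text{if } n \text{ is an odd multiple of } 12;\\ 5, & \text{if } n \text{ is a multiple of } 10, \text{ but not of } 12;\\ 4, & \text{if } n = 8K \text{ for some integer } K>0 \text{ coprime to } 15;\\ 3+\delta_3(n), & \text{if } n = 6K \text{ for some integer } K > 0 \text{ coprime to } 10;\\ 3+\delta_3(n), & \text{if } n=4K \text{ for some integer } K > 1 \text{ coprime to } 30;\\ 3, & \text{if } n = 2K \text{ for some integer } K>1 \text{ coprime to } 30;\\ 2, & \text{if } n=4;\\ 1, & \text{if } n = 2.\end{cases}$$ In particular (together with the case of odd $n$), $\mathrm{diam}(G_n) \le 12$ for all $n \ge 1$, and $\mathrm{diam}(G_{p^m}) \le 4$ for any prime $p$ and $m \ge 0$.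
   Context: For an integer $n \ge 1$, $Q_n = \{u^2 : u \in \mathbb{Z}_n^\times\}$ and $T_n = \pm Q_n = \{\pm u^2 : u \in \mathbb{Z}_n^\times\}$. The quadratic unitary Cayley graph $G_n = \mathrm{Cay}(\mathbb{Z}_n, T_n)$ is the undirected graph with vertex set $\mathbb{Z}_n$ in which $a,b$ are adjacent iff $a-b \in T_n$. $\mathrm{diam}$ denotes the graph diameter. *)

theory Defs
  imports "HOL-Number_Theory.Cong" "Graph_Theory.Shortest_Path"
begin

text \<open>
  The ring of integers modulo \<open>n\<close> is represented by the residues \<open>0, \<dots>, n - 1\<close> (as integers),
  with arithmetic taken \<open>mod n\<close>. For \<open>n = 1\<close> this is the zero ring, whose only element is a unit.
\<close>

definition Zmod :: "nat \<Rightarrow> int set" where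
  "Zmod n = {0..<int n}"

definition Zmod_units :: "nat \<Rightarrow> int set" where
  "Zmod_units n = {u \<in> Zmod n. \<exists>v \<in> Zmod n. [u * v = 1] (mod int n)}"

definition Qset :: "nat \<Rightarrow> int set" where
  "Qset n = (\<lambda>u. u\<^sup>2 mod int n) ` Zmod_units n"

definition Tset :: "nat \<Rightarrow> int set" where
  "Tset n = Qset n \<union> (\<lambda>q. (- q) mod int n) ` Qset n"

text \<open>
  Undirected graphs are symmetric digraphs: every edge is represented by both of its orientations.
\<close>

definition Cay :: "nat \<Rightarrow> int set \<Rightarrow> (int, int \<times> int) pre_digraph" where
  "Cay n S = \<lparr>verts = Zmod n,
     arcs = {(a, b). a \<in> Zmod n \<and> b \<in> Zmod n \<and> (a - b) mod int n \<in> S},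
     tail = fst, head = snd\<rparr>"

definition quad_unitary_Cayley :: "nat \<Rightarrow> (int, int \<times> int) pre_digraph" where
  "quad_unitary_Cayley n = Cay n (Tset n)"

text \<open>
  With unit weights, \<open>wf_digraph.\<mu>\<close> is the length of a shortest walk (\<open>\<infinity>\<close> if there is none), so
  the diameter of a disconnected graph is \<open>\<infinity>\<close>.
\<close>

definition diameter :: "('a, 'b) pre_digraph \<Rightarrow> ereal" where
  "diameter G = (SUP u \<in> verts G. SUP v \<in> verts G. wf_digraph.\<mu> G (\<lambda>_. 1) u v)"

definition delta3 :: "nat \<Rightarrow> nat" where
  "delta3 n = (if \<exists>p. prime p \<and> p dvd n \<and> p > 3 \<and> [p = 3] (mod 4) then 1 else 0)"

lemma wf_digraph_Cay: "wf_digraph (Cay n S)"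
  by unfold_locales (auto simp: Cay_def)

lemma Tset_uminus:
  assumes "t \<in> Tset n"
  shows "(- t) mod int n \<in> Tset n"
  using assms by (auto simp: Tset_def Qset_def mod_minus_eq)

lemma pseudo_graph_quad_unitary_Cayley: "pseudo_graph (quad_unitary_Cayley n)"
proof -
  interpret wf_digraph "quad_unitary_Cayley n"
    unfolding quad_unitary_Cayley_def by (rule wf_digraph_Cay)
  have "finite (Zmod n \<times> Zmod n)"
    by (simp add: Zmod_def)
  moreover have "arcs (quad_unitary_Cayley n) \<subseteq> Zmod n \<times> Zmod n"
    by (auto simp: quad_unitary_Cayley_def Cay_def)
  ultimately have "finite (arcs (quad_unitary_Cayley n))"
    by (rule finite_subset[rotated])
  moreover have "finite (verts (quad_unitary_Cayley n))"
    by (simp add: quad_unitary_Cayley_def Cay_def Zmod_def)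
  moreover have "(b - a) mod int n \<in> Tset n" if "(a - b) mod int n \<in> Tset n" for a b
    using Tset_uminus[OF that] by (simp add: mod_minus_eq)
  then have "symmetric (quad_unitary_Cayley n)"
    by (auto simp: symmetric_conv quad_unitary_Cayley_def Cay_def)
  ultimately show ?thesis
    by unfold_locales auto
qed

end

theory Submission
  imports Defs "HOL-Number_Theory.Euler_Criterion"
begin

text \<open>
  A walk of length \<open>k\<close> from \<open>a\<close> to \<open>b\<close> exists iff \<open>a - b\<close> is a sum of \<open>k\<close> signed unit squares
  modulo \<open>n\<close>. For a fixed list of signs, such representations glue along the Chinese remainder
  theorem and lift from \<open>8\<close> or an odd prime \<open>p\<close> to its powers. Modulo divisors of \<open>24\<close> every unit
  square is \<open>1\<close>, so there the representable residue is the sum of the signs. Modulo \<open>5\<close> every unit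
  square is \<open>1\<close> or \<open>-1\<close> and four terms reach everything. Modulo \<open>p \<ge> 7\<close> three terms reach
  everything, and two terms miss at most the residue \<open>0\<close>, which happens for equal signs and
  \<open>p \<equiv> 3\<close> modulo \<open>4\<close>. Upper bounds choose signs whose sum is the least absolute residue modulo
  \<open>gcd n 24\<close>. Lower bounds use that unit squares are \<open>1\<close> or \<open>-1\<close> modulo \<open>10\<close> and modulo the even
  divisors of \<open>24\<close>, an element divisible by a prime of \<open>n\<close> (not one signed unit square), or \<open>2 p\<close>
  with \<open>p \<equiv> 3\<close> modulo \<open>4\<close>, where a congruence modulo \<open>4\<close> or \<open>6\<close> forces equal signs.
\<close>

section \<open>Signed sums of unit squares and gluing over coprime moduli\<close>

lemma coprime_int_prime_iff:
  assumes "prime p"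
  shows "coprime v (int p) \<longleftrightarrow> \<not> int p dvd v"
  using assms prime_imp_coprime[of "int p" v] prime_gt_1_nat[OF assms]
  by (auto simp: coprime_commute)

text \<open>The signs are an argument while the units are existential: gluing over coprime moduli
  can merge units freely, but the sign of a term must be the same modulo both factors. Units are
  arbitrary integers coprime to \<open>m\<close>, which spares reducing every witness.\<close>

primrec unit_square_sum :: "int list \<Rightarrow> int \<Rightarrow> int \<Rightarrow> bool" where
  "unit_square_sum [] m x \<longleftrightarrow> [x = 0] (mod m)"
| "unit_square_sum (s # ss) m x \<longleftrightarrow> (\<exists>u. coprime u m \<and> unit_square_sum ss m (x - s * u\<^sup>2))"

lemma unit_square_sum_cong:
  assumes "[x = y] (mod m)"
  shows "unit_square_sum ss m x \<longleftrightarrow> unit_square_sum ss m y"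
  using assms
proof (induction ss arbitrary: x y)
  case Nil
  then show ?case by (auto simp: cong_def)
next
  case (Cons s ss)
  have "[x - s * u\<^sup>2 = y - s * u\<^sup>2] (mod m)" for u
    using Cons.prems by (simp add: cong_diff)
  then show ?case using Cons.IH by (metis unit_square_sum.simps(2))
qed

lemma unit_square_sum_dvd_modulus:
  assumes "unit_square_sum ss m x" "d dvd m"
  shows "unit_square_sum ss d x"
  using assms
proof (induction ss arbitrary: x)
  case Nil
  then show ?case by (auto simp: cong_0_iff)
next
  case (Cons s ss)
  then show ?case by (metis unit_square_sum.simps(2) coprime_divisors dvd_refl)
qed

text \<open>The Chinese remainder theorem merges the two units of each term into one; the sign in
  front of them is common to both moduli.\<close>

lemma unit_square_sum_mult:
  assumes "coprime a b" "unit_square_sum ss a x" "unit_square_sum ss b x"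
  shows "unit_square_sum ss (a * b) x"
  using assms(2,3)
proof (induction ss arbitrary: x)
  case Nil
  then show ?case using \<open>coprime a b\<close> by (simp add: coprime_cong_mult)
next
  case (Cons s ss)
  from Cons.prems obtain u v where
    u: "coprime u a" "unit_square_sum ss a (x - s * u\<^sup>2)" and
    v: "coprime v b" "unit_square_sum ss b (x - s * v\<^sup>2)" by auto
  obtain w where w: "[w = u] (mod a)" "[w = v] (mod b)"
    using binary_chinese_remainder_int[OF \<open>coprime a b\<close>] by blast
  have "coprime w (a * b)"
    using u(1) v(1) w by (metis cong_imp_coprime cong_sym coprime_mult_right_iff)
  moreover have "[x - s * w\<^sup>2 = x - s * u\<^sup>2] (mod a)" "[x - s * w\<^sup>2 = x - s * v\<^sup>2] (mod b)"
    using w by (auto intro!: cong_diff cong_mult cong_pow)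
  then have "unit_square_sum ss (a * b) (x - s * w\<^sup>2)"
    using u v Cons.IH unit_square_sum_cong by blast
  ultimately show ?case by auto
qed

text \<open>Strong induction splitting off one prime at a time. Asking for every prime power
  dividing \<open>n\<close>, rather than the maximal ones, lets the hypothesis pass directly to the
  cofactor.\<close>

lemma unit_square_sum_prime_powers:
  fixes n :: nat
  assumes "n > 0"
    and "\<And>p k. prime p \<Longrightarrow> k > 0 \<Longrightarrow> p ^ k dvd n \<Longrightarrow> unit_square_sum ss (int p ^ k) x"
  shows "unit_square_sum ss (int n) x"
  using assms
proof (induction n rule: less_induct)
  case (less n)
  show ?case
  proof (cases "n = 1")
    case True
    have "unit_square_sum ss 1 x" by (induction ss arbitrary: x) auto
    then show ?thesis using True by simp
  next
    case False
    then obtain p where p: "prime p" "p dvd n" using prime_factor_nat by blast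
    \<comment> \<open>The full multiplicity leaves \<open>m\<close> prime to \<open>p\<close>, as
      gluing requires.\<close>
    define k where "k = multiplicity p n"
    have "n \<noteq> 0" "\<not> is_unit p" using less.prems(1) p(1) not_prime_unit by auto
    then obtain m where m: "n = p ^ k * m" "\<not> p dvd m"
      unfolding k_def by (rule multiplicity_decompose')
    have k: "k > 0" using p less.prems(1) unfolding k_def
      by (simp add: prime_multiplicity_gt_zero_iff)
    have "m > 0" using m less.prems(1) by (cases m) auto
    have "p ^ k > 1" using prime_gt_1_nat[OF p(1)] k by (rule one_less_power)
    then have "m < n" using m(1) \<open>m > 0\<close> by simp
    have "unit_square_sum ss (int m) x"
      using less.IH[OF \<open>m < n\<close> \<open>m > 0\<close>] less.prems(2) m by simp
    moreover have "unit_square_sum ss (int p ^ k) x"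
      using less.prems(2)[OF p(1) k] m by simp
    moreover have "coprime (int p ^ k) (int m)"
      using m(2) p(1) by (simp add: prime_imp_coprime coprime_power_left_iff)
    ultimately show ?thesis using unit_square_sum_mult m(1) by simp
  qed
qed

section \<open>Lifting to prime powers\<close>

text \<open>Hensel lifting: a root is corrected by a multiple of \<open>p ^ k\<close>, and the
  linear condition on the correction is solvable because the derivative \<open>2 * v\<close> is a
  unit modulo the odd prime \<open>p\<close>.\<close>

lemma square_lift_odd_prime_power:
  fixes a u :: int
  assumes "prime p" "p \<noteq> 2" "\<not> int p dvd u" "[a = u\<^sup>2] (mod int p)" "k > 0"
  shows "\<exists>v. \<not> int p dvd v \<and> [a = v\<^sup>2] (mod int p ^ k)"
  using \<open>k > 0\<close>
proof (induction k rule: nat_induct_non_zero)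
  case 1
  then show ?case using assms by auto
next
  case (Suc k)
  then obtain v where v: "\<not> int p dvd v" "[a = v\<^sup>2] (mod int p ^ k)" by blast
  obtain c where c: "a = v\<^sup>2 + int p ^ k * c" 
    using v(2) by (metis cong_iff_lin cong_sym)
  have "odd p" using assms(1,2) primes_dvd_imp_eq two_is_prime_nat by blast
  have "coprime (2 * v) (int p)"
    using v(1) assms(1) \<open>odd p\<close> by (simp add: coprime_int_prime_iff coprime_commute)
  then obtain t where "[2 * v * t = c] (mod int p)"
    using cong_solve_coprime_int[of "2*v" "int p"] by (metis cong_scalar_left mult.assoc mult.commute mult_1)
  then obtain e where e: "c = 2 * v * t + int p * e" by (metis cong_iff_lin)
  define w where "w = v + int p ^ k * t"
  \<comment> \<open>The quadratic error \<open>p ^ (2 * k)\<close> times \<open>t\<^sup>2\<close>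
    contains \<open>p ^ Suc k\<close> since \<open>k > 0\<close>, leaving the exponent
    \<open>k - 1\<close>.\<close>
  have "a = w\<^sup>2 + int p ^ Suc k * (e - int p ^ (k - 1) * t\<^sup>2)"
    using \<open>k > 0\<close> by (cases k) (simp_all add: c e w_def power2_eq_square algebra_simps)
  then have "[a = w\<^sup>2] (mod int p ^ Suc k)" by (metis cong_iff_lin cong_sym)
  moreover have "\<not> int p dvd w" using v(1) \<open>k > 0\<close> unfolding w_def
    by (simp add: dvd_add_left_iff dvd_power)
  ultimately show ?case by blast
qed

text \<open>The derivative is even here, so the correction is a multiple of
  \<open>2 ^ (k + 2)\<close>, one power below the modulus; multiplied by 2 and by the odd
  \<open>v\<close>, it cancels the error modulo \<open>2 ^ (k + 4)\<close>.\<close>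

lemma square_lift_two_power:
  fixes a :: int
  assumes "[a = 1] (mod 8)"
  shows "\<exists>v. odd v \<and> [a = v\<^sup>2] (mod 2 ^ k)"
proof -
  have "\<exists>v. odd v \<and> [a = v\<^sup>2] (mod 2 ^ (k + 3))"
  proof (induction k)
    case 0
    then show ?case using assms by (intro exI[of _ 1]) auto
  next
    case (Suc k)
    then obtain v where v: "odd v" "[a = v\<^sup>2] (mod 2 ^ (k + 3))" by blast
    obtain c where c: "a = v\<^sup>2 + 2 ^ (k + 3) * c" 
      using v(2) by (metis cong_iff_lin cong_sym)
    obtain d where d: "v = 2 * d + 1" using v(1) by (auto elim: oddE)
    define w where "w = v + 2 ^ (k + 2) * c"
    have "a = w\<^sup>2 + 2 ^ (Suc k + 3) * (- d * c - 2 ^ k * c\<^sup>2)"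
      by (simp add: c w_def d power2_eq_square algebra_simps power_add)
    then have "[a = w\<^sup>2] (mod 2 ^ (Suc k + 3))" by (metis cong_iff_lin cong_sym)
    moreover have "odd w" using v(1) unfolding w_def by simp
    ultimately show ?case by blast
  qed
  then obtain v where "odd v" "[a = v\<^sup>2] (mod 2 ^ (k + 3))" by blast
  moreover have "(2::int) ^ k dvd 2 ^ (k + 3)" by (simp add: le_imp_power_dvd)
  ultimately show ?thesis using cong_dvd_modulus by blast
qed

text \<open>Units modulo \<open>p\<close> remain units modulo \<open>p ^ k\<close>, so all terms but
  the last keep their unit. The last one absorbs the remainder, which is a signed unit square modulo
  \<open>p\<close> and hence liftable.\<close>

lemma unit_square_sum_lift_odd_prime_power:
  assumes "prime p" "p \<noteq> 2" "ss \<noteq> []" "set ss \<subseteq> {1, -1}" "unit_square_sum ss (int p) x" "k > 0"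
  shows "unit_square_sum ss (int p ^ k) x"
  using assms(3-5)
proof (induction ss arbitrary: x rule: list_nonempty_induct)
  case (single s)
  then obtain u where u: "coprime u (int p)" "[x = s * u\<^sup>2] (mod int p)"
    by (auto simp: cong_diff_iff_cong_0)
  have s: "s * s = 1" using single by auto
  have "[s * x = s * (s * u\<^sup>2)] (mod int p)" using u(2) by (intro cong_mult cong_refl)
  then have "[s * x = u\<^sup>2] (mod int p)" using s by (simp add: mult.assoc[symmetric])
  moreover have "\<not> int p dvd u" using u(1) assms(1) by (simp add: coprime_int_prime_iff)
  ultimately obtain v where v: "\<not> int p dvd v" "[s * x = v\<^sup>2] (mod int p ^ k)"
    using square_lift_odd_prime_power assms by blast
  have "[s * (s * x) = s * v\<^sup>2] (mod int p ^ k)" using v(2) by (intro cong_mult cong_refl)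
  then have "[x = s * v\<^sup>2] (mod int p ^ k)" using s by (simp add: mult.assoc[symmetric])
  moreover have "coprime v (int p ^ k)" using v(1) assms(1)
    by (simp add: coprime_int_prime_iff)
  ultimately show ?case by (auto simp: cong_diff_iff_cong_0)
next
  case (cons s ss)
  then show ?case by auto
qed

text \<open>Up to modulus 8 all units can be 1. Beyond that, all but the last are 1, and the last
  square is lifted from modulus 8.\<close>

lemma unit_square_sum_two_power:
  assumes "ss \<noteq> []" "set ss \<subseteq> {1, -1}" "[x = sum_list ss] (mod gcd 8 (2 ^ k))"
  shows "unit_square_sum ss (2 ^ k) x"
proof (cases "k \<le> 3")
  case True
  have g: "gcd 8 (2 ^ k) = (2::int) ^ k"
    using gcd_proj2_if_dvd[of "2^k" "8::int"] le_imp_power_dvd[OF True, of "2::int"] by simp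
  have "unit_square_sum ss m (sum_list ss)" for m
    by (induction ss) (auto intro!: exI[of _ 1])
  then show ?thesis using assms(3) unit_square_sum_cong unfolding g by blast
next
  case False
  have g: "gcd 8 (2 ^ k) = (8::int)"
    using gcd_proj1_if_dvd[of "8::int" "2^k"] le_imp_power_dvd[of 3 k "2::int"] False by simp
  have "[x = sum_list ss] (mod 8)" using assms(3) g by simp
  with assms(1,2) show ?thesis
  proof (induction ss arbitrary: x rule: list_nonempty_induct)
    case (single s)
    have s: "s * s = 1" using single by auto
    have "[s * x = s * s] (mod 8)" using single by (intro cong_mult cong_refl) auto
    then obtain v where v: "odd v" "[s * x = v\<^sup>2] (mod 2 ^ k)"
      using square_lift_two_power s by metis
    have "[s * (s * x) = s * v\<^sup>2] (mod 2 ^ k)" using v(2) by (intro cong_mult cong_refl)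
    then have "[x = s * v\<^sup>2] (mod 2 ^ k)" using s by (simp add: mult.assoc[symmetric])
    then show ?case using v(1) by (auto simp: cong_diff_iff_cong_0)
  next
    case (cons s ss)
    have "[x - s = sum_list ss] (mod 8)"
      using cong_diff[OF cons.prems(2) cong_refl[of s]] by simp
    then have "unit_square_sum ss (2 ^ k) (x - s)" using cons by auto
    then show ?case by (auto intro!: exI[of _ 1])
  qed
qed

lemma unit_square_sum_sum_list: "unit_square_sum ss m (sum_list ss)"
  by (induction ss) (auto intro!: exI[of _ 1])

lemma unit_square_sum_3_power:
  assumes "ss \<noteq> []" "set ss \<subseteq> {1, -1}" "[x = sum_list ss] (mod 3)" "k > 0"
  shows "unit_square_sum ss (3 ^ k) x"
  using unit_square_sum_lift_odd_prime_power[of 3 ss x k] assms unit_square_sum_cong[OF assms(3)]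
    unit_square_sum_sum_list by simp

section \<open>Two terms modulo a prime\<close>

lemma unit_square_sum_pair:
  "unit_square_sum [s, t] m x \<longleftrightarrow>
     (\<exists>u v. coprime u m \<and> coprime v m \<and> [x = s * u\<^sup>2 + t * v\<^sup>2] (mod m))"
  by (auto simp: cong_iff_dvd_diff cong_0_iff algebra_simps)

text \<open>Sums and differences of two elements of this half system are below \<open>p\<close> in
  absolute value, so different elements have different squares. The shift \<open>a\<close> and the
  sign \<open>s\<close> serve both sets of the pigeonhole argument below.\<close>

lemma inj_on_square_mod_prime:
  assumes "prime p" "odd p" "s \<in> {1, -1}"
  shows "inj_on (\<lambda>u. (a + s * u\<^sup>2) mod int p) {0..int (p div 2)}"
proof (rule inj_onI)
  fix u v assume u: "u \<in> {0..int (p div 2)}" and v: "v \<in> {0..int (p div 2)}"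
    and "(a + s * u\<^sup>2) mod int p = (a + s * v\<^sup>2) mod int p"
  then have "int p dvd (a + s * u\<^sup>2) - (a + s * v\<^sup>2)" by (simp only: mod_eq_dvd_iff)
  moreover have "(a + s * u\<^sup>2) - (a + s * v\<^sup>2) = s * ((u - v) * (u + v))"
    by (simp add: power2_eq_square algebra_simps)
  ultimately have "int p dvd (u - v) * (u + v)" using assms(3) by auto
  then consider "int p dvd u - v" | "int p dvd u + v"
    using assms(1) prime_dvd_mult_iff[of "int p"] by auto
  moreover have "\<bar>u - v\<bar> < int p" "\<bar>u + v\<bar> < int p" 
    using u v \<open>odd p\<close> by (auto simp: abs_if elim!: oddE)
  ultimately show "u = v"
  proof cases
    case 1
    then show ?thesis using \<open>\<bar>u - v\<bar> < int p\<close> dvd_imp_le_int[of "u - v" "int p"] by auto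
  next
    case 2
    then have "u + v = 0" using \<open>\<bar>u + v\<bar> < int p\<close> dvd_imp_le_int[of "u + v" "int p"] by fastforce
    then show ?thesis using u v by auto
  qed
qed

text \<open>Pigeonhole: the values of \<open>s * u\<^sup>2\<close> and of
  \<open>x - t * v\<^sup>2\<close> each fill (p + 1)/2 residues, so they meet. The resulting
  \<open>u\<close> and \<open>v\<close> may still be divisible by \<open>p\<close>.\<close>

lemma signed_square_sum_mod_prime:
  fixes x :: int
  assumes "prime p" "odd p" "s \<in> {1, -1}" "t \<in> {1, -1}"
  shows "\<exists>u v. [x = s * u\<^sup>2 + t * v\<^sup>2] (mod int p)"
proof -
  define I where "I = {0..int (p div 2)}"
  \<comment> \<open>The summand 0 matches the shape of
    \<open>inj_on_square_mod_prime\<close>.\<close>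
  define F where "F = (\<lambda>u. (0 + s * u\<^sup>2) mod int p) ` I"
  define G where "G = (\<lambda>v. (x + (- t) * v\<^sup>2) mod int p) ` I"
  have "F \<union> G \<subseteq> {0..<int p}"
    using prime_gt_0_nat[OF assms(1)] by (auto simp: F_def G_def)
  then have "card (F \<union> G) \<le> p" 
    using card_mono[of "{0..<int p}" "F \<union> G"] by simp
  moreover have "card F = card I"
    unfolding F_def I_def by (intro card_image inj_on_square_mod_prime) (use assms in auto)
  moreover have "card G = card I"
    unfolding G_def I_def by (intro card_image inj_on_square_mod_prime) (use assms in auto)
  moreover have "card I + card I > p"
    using \<open>odd p\<close> unfolding I_def by (auto elim!: oddE)
  moreover have "card (F \<union> G) + card (F \<inter> G) = card F + card G"
    using card_Un_Int[of F G] by (simp add: F_def G_def I_def)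
  ultimately have "F \<inter> G \<noteq> {}" by fastforce
  then obtain u v where "(0 + s * u\<^sup>2) mod int p = (x + (- t) * v\<^sup>2) mod int p"
    unfolding F_def G_def by fastforce
  then have "[x = s * u\<^sup>2 + t * v\<^sup>2] (mod int p)"
    by (auto simp: mod_eq_dvd_iff cong_iff_dvd_diff dvd_diff_commute algebra_simps)
  then show ?thesis by blast
qed

lemma coprime_prime_small:
  assumes "prime p" "p > 5" "q \<in> {3, 4, 5}"
  shows "coprime q (int p)"
proof -
  have "\<not> int p dvd q" using assms zdvd_imp_le[of "int p" q] by auto
  then show ?thesis by (simp add: coprime_int_prime_iff assms(1))
qed

text \<open>The identities 3^2 + 4^2 = 5^2 and 5^2 - 3^2 = 4^2 turn one unit square into two.\<close>

lemma square_eq_two_signed_unit_squares: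
  fixes w :: int
  assumes "prime p" "p > 5" "coprime w (int p)" "s \<in> {1, -1}" "t \<in> {1, -1}"
  shows "\<exists>u v. coprime u (int p) \<and> coprime v (int p) \<and> [s * w\<^sup>2 = s * u\<^sup>2 + t * v\<^sup>2] (mod int p)"
proof -
  obtain a b c :: int where abc: "s * c\<^sup>2 = s * a\<^sup>2 + t * b\<^sup>2" "{a, b, c} \<subseteq> {3, 4, 5}"
  proof (cases "s = t")
    case True
    then show ?thesis using that[of 5 3 4] by simp
  next
    case False
    then show ?thesis using that[of 4 5 3] assms(4,5) by auto
  qed
  then have cop: "coprime a (int p)" "coprime b (int p)" "coprime c (int p)"
    using coprime_prime_small[OF assms(1,2)] by auto
  \<comment> \<open>With \<open>i\<close> inverse to \<open>c\<close>, scaling the identity by the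
    square of \<open>w * i\<close> turns its left side into \<open>s * w\<^sup>2\<close> modulo
    \<open>p\<close>.\<close>
  obtain i where i: "[c * i = 1] (mod int p)"
    using cong_solve_coprime_int[OF cop(3)] by blast
  then have "coprime i (int p)"
    by (metis cong_imp_coprime cong_sym coprime_1_left coprime_mult_left_iff)
  moreover have "[s * (w * (c * i))\<^sup>2 = s * (w * 1)\<^sup>2] (mod int p)"
    by (intro cong_mult cong_pow cong_refl i)
  moreover have "s * (w * (c * i))\<^sup>2 = (s * c\<^sup>2) * (w * i)\<^sup>2"
    by (simp add: power_mult_distrib)
  moreover have "\<dots> = s * (a * w * i)\<^sup>2 + t * (b * w * i)\<^sup>2"
    unfolding abc(1) by (simp add: power_mult_distrib algebra_simps)
  ultimately show ?thesis using cop assms(3)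
    by (intro exI[of _ "a * w * i"] exI[of _ "b * w * i"]) (simp add: cong_sym)
qed

text \<open>If exactly one of the two squares from the pigeonhole argument vanishes modulo
  \<open>p\<close>, the other one is split into two signed unit squares with the same pair of signs.
  Both vanish only if \<open>p\<close> divides \<open>x\<close>.\<close>

lemma unit_square_sum_pair_prime:
  assumes p: "prime p" "p > 5" and st: "s \<in> {1, -1}" "t \<in> {1, -1}" and "\<not> int p dvd x"
  shows "unit_square_sum [s, t] (int p) x"
proof -
  have "odd p" using p prime_odd_nat by auto
  then obtain u v where uv: "[x = s * u\<^sup>2 + t * v\<^sup>2] (mod int p)"
    using signed_square_sum_mod_prime p st by blast
  note iff = coprime_int_prime_iff[OF p(1)]
  consider "\<not> int p dvd u" "\<not> int p dvd v" | "int p dvd u" "\<not> int p dvd v"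
    | "\<not> int p dvd u" "int p dvd v" | "int p dvd u" "int p dvd v" by blast
  then show ?thesis
  proof cases
    case 1
    then show ?thesis using uv iff unfolding unit_square_sum_pair by blast
  next
    case 2
    then obtain a b where ab: "coprime a (int p)" "coprime b (int p)" 
      "[t * v\<^sup>2 = t * a\<^sup>2 + s * b\<^sup>2] (mod int p)"
      using square_eq_two_signed_unit_squares[OF p _ st(2) st(1)] iff by blast
    have "[s * u\<^sup>2 + t * v\<^sup>2 = 0 + (t * a\<^sup>2 + s * b\<^sup>2)] (mod int p)"
      using 2 ab(3) by (intro cong_add) (auto simp: cong_0_iff power2_eq_square)
    then have "[x = s * b\<^sup>2 + t * a\<^sup>2] (mod int p)" 
      using cong_trans[OF uv] by (simp add: add.commute)
    then show ?thesis using ab unfolding unit_square_sum_pair by blast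
  next
    case 3
    then obtain a b where ab: "coprime a (int p)" "coprime b (int p)" 
      "[s * u\<^sup>2 = s * a\<^sup>2 + t * b\<^sup>2] (mod int p)"
      using square_eq_two_signed_unit_squares[OF p _ st] iff by blast
    have "[s * u\<^sup>2 + t * v\<^sup>2 = (s * a\<^sup>2 + t * b\<^sup>2) + 0] (mod int p)"
      using 3 ab(3) by (intro cong_add) (auto simp: cong_0_iff power2_eq_square)
    then have "[x = s * a\<^sup>2 + t * b\<^sup>2] (mod int p)" 
      using cong_trans[OF uv] by simp
    then show ?thesis using ab unfolding unit_square_sum_pair by blast
  next
    case 4
    then have "[x = 0] (mod int p)"
      using cong_trans[OF uv, of 0] by (auto simp: cong_0_iff power2_eq_square)
    then show ?thesis using \<open>\<not> int p dvd x\<close> by (simp add: cong_0_iff)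
  qed
qed

section \<open>Minus one as a square modulo a prime\<close>

text \<open>Euler's criterion with (p - 1)/2 even. The root lets two terms of equal sign cancel
  modulo \<open>p\<close>.\<close>

lemma minus_one_square_mod_prime:
  assumes "prime p" "[p = 1] (mod 4)"
  shows "\<exists>i. [i\<^sup>2 = - 1] (mod int p)"
proof -
  have "p > 2" using assms prime_ge_2_nat[of p] by (cases "p = 2") (auto simp: cong_def)
  moreover have "even ((p - 1) div 2)" using assms(2) by (simp add: cong_def) presburger
  ultimately have "[Legendre (- 1) (int p) = 1] (mod int p)"
    using euler_criterion[OF assms(1), of "- 1"] by simp
  moreover have "\<not> [- 1 = (1::int)] (mod int p)" "\<not> [0 = (1::int)] (mod int p)"
    using \<open>p > 2\<close> zdvd_imp_le[of "int p" 2] by (auto simp: cong_iff_dvd_diff)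
  ultimately show ?thesis by (auto simp: Legendre_def QuadRes_def split: if_splits)
qed

text \<open>Otherwise division by \<open>v\<^sup>2\<close> makes -1 a square, against Euler's
  criterion with (p - 1)/2 odd. This is the obstruction behind \<open>delta3\<close>.\<close>

lemma sum_two_squares_prime_3_mod_4:
  fixes u v :: int
  assumes "prime p" "[p = 3] (mod 4)" "int p dvd u\<^sup>2 + v\<^sup>2"
  shows "int p dvd v"
proof (rule ccontr)
  assume "\<not> int p dvd v"
  then obtain i where i: "[v * i = 1] (mod int p)"
    using cong_solve_coprime_int coprime_int_prime_iff[OF assms(1)] by blast
  have "[(u * i)\<^sup>2 + (v * i)\<^sup>2 = 0] (mod int p)"
    using dvd_mult2[OF assms(3), of "i\<^sup>2"] by (simp add: cong_0_iff power_mult_distrib distrib_right)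
  moreover have "[(u * i)\<^sup>2 + (v * i)\<^sup>2 = (u * i)\<^sup>2 + 1\<^sup>2] (mod int p)"
    by (intro cong_add cong_pow cong_refl i)
  ultimately have "[(u * i)\<^sup>2 + 1 = 0] (mod int p)" by (metis cong_sym cong_trans power_one)
  then have "QuadRes (int p) (- 1)"
    by (auto simp: QuadRes_def cong_iff_dvd_diff cong_0_iff)
  have "p > 2" using assms(1,2) prime_ge_2_nat[of p] by (cases "p = 2") (auto simp: cong_def)
  then have "\<not> [- 1 = (1::int)] (mod int p)" "\<not> [-1 = (0::int)] (mod int p)"
    using zdvd_imp_le[of "int p" 2] by (auto simp: cong_iff_dvd_diff)
  moreover have "odd ((p - 1) div 2)" using assms(2) by (simp add: cong_def) presburger
  ultimately show False
    using euler_criterion[OF assms(1) \<open>p > 2\<close>, of "- 1"] \<open>QuadRes (int p) (- 1)\<close>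
    by (auto simp: Legendre_def cong_sym_eq)
qed

section \<open>Longer sums modulo primes from 5 on\<close>

text \<open>Surplus terms take the unit 1 until three remain. The first of these takes 1 or 2: the
  two remainders differ by \<open>3 * s\<close>, so \<open>p\<close> does not divide both, and two
  terms reach the remainder that it misses.\<close>

lemma unit_square_sum_prime_ge_7:
  assumes p: "prime p" "p > 5" and "length ss \<ge> 3" "set ss \<subseteq> {1, -1}"
  shows "unit_square_sum ss (int p) x"
  using assms(3,4)
proof (induction ss arbitrary: x)
  case Nil
  then show ?case by simp
next
  case (Cons s ss)
  show ?case
  proof (cases "length ss \<ge> 3")
    case True
    then show ?thesis using Cons by (auto intro!: exI[of _ 1])
  next
    case False
    then obtain t r where ss: "ss = [t, r]" using Cons.prems(1)
      by (cases ss; cases "tl ss"; cases "tl (tl ss)") auto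
    have 3: "\<not> int p dvd 3" using p zdvd_imp_le[of "int p" 3] by auto
    have c2: "coprime 2 (int p)" using p prime_odd_nat by auto
    have "(x - s * 1\<^sup>2) - (x - s * 2\<^sup>2) = 3 * s" by simp
    moreover have "\<not> int p dvd 3 * s" using 3 Cons.prems(2) by auto
    ultimately have "\<not> int p dvd x - s * 1\<^sup>2 \<or> \<not> int p dvd x - s * 2\<^sup>2"
      by (metis dvd_diff)
    then obtain u where "coprime u (int p)" "\<not> int p dvd x - s * u\<^sup>2"
      using c2 coprime_1_left by blast
    then show ?thesis using unit_square_sum_pair_prime[OF p] Cons.prems(2) ss
      by (metis insert_subset list.simps(15) unit_square_sum.simps(2))
  qed
qed

text \<open>Since 2^2 = -1 modulo 5, each term can be made 1 or -1 whatever its sign;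
  \<open>es\<close> lists the chosen values.\<close>

lemma unit_square_sum_5:
  assumes "length ss \<ge> 4" "set ss \<subseteq> {1, -1}"
  shows "unit_square_sum ss 5 x"
proof -
  have sq: "\<exists>u. coprime u 5 \<and> [s * u\<^sup>2 = e] (mod 5)" if "s \<in> {1, -1}" "e \<in> {1, -1}" for s e :: int
    using that by (intro exI[of _ "if s = e then 1 else 2"]) (auto simp: cong_def)
  have reach: "unit_square_sum ss 5 x" 
    if "set ss \<subseteq> {1, -1}" "set es \<subseteq> {1, -1}" "length es = length ss" "[x = sum_list es] (mod 5)" for ss es x
    using that
  proof (induction ss arbitrary: es x)
    case Nil
    then show ?case by simp
  next
    case (Cons s ss)
    then obtain e es' where es: "es = e # es'" by (cases es) auto
    obtain u where u: "coprime u 5" "[s * u\<^sup>2 = e] (mod 5)" using sq[of s e] Cons.prems es by auto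
    have "[x - s * u\<^sup>2 = sum_list es - e] (mod 5)" using Cons.prems(4) u(2) by (rule cong_diff)
    then have "unit_square_sum ss 5 (x - s * u\<^sup>2)" using Cons.IH[of es'] Cons.prems es by auto
    then show ?case using u(1) by auto
  qed
  \<comment> \<open>Four values from 1 and -1 have sums 0, 2, -2, 4, -4, which cover all residues
    modulo 5.\<close>
  define es4 where "es4 y = (if y mod 5 = (0::int) then [1, 1, -1, -1] else if y mod 5 = 1 then [-1, -1, -1, -1]
    else if y mod 5 = 2 then [1, 1, 1, -1] else if y mod 5 = 3 then [-1, -1, -1, 1] else [1, 1, 1, 1::int])" for y
  have es4: "set (es4 y) \<subseteq> {1, -1}" "length (es4 y) = 4" "[y = sum_list (es4 y)] (mod 5)" for y
  proof -
    have "y mod 5 \<in> {0, 1, 2, 3, 4}" by auto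
    then show "[y = sum_list (es4 y)] (mod 5)" by (auto simp: es4_def cong_def)
  qed (auto simp: es4_def)
  define k where "k = length ss - 4"
  have "sum_list (replicate k (1::int)) = int k" for k by (induction k) auto
  then show ?thesis
    \<comment> \<open>The \<open>k\<close> surplus terms contribute 1 each, which shifts the target
      to \<open>x - int k\<close>.\<close>
    using reach[of ss "replicate k 1 @ es4 (x - int k)" x] assms es4[of "x - int k"]
    by (auto simp: k_def cong_iff_dvd_diff algebra_simps set_replicate_conv_if)
qed

section \<open>From walks to signed sums\<close>

lemma Tset_iff:
  assumes "n > 0"
  shows "t \<in> Tset n \<longleftrightarrow> (\<exists>s \<in> {1, -1}. \<exists>u. coprime u (int n) \<and> t = (s * u\<^sup>2) mod int n)"
proof -
  have units: "u \<in> Zmod_units n \<longleftrightarrow> u \<in> Zmod n \<and> coprime u (int n)" for u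
    using coprime_iff_invertible'_int[of "int n" u] assms by (auto simp: Zmod_units_def Zmod_def)
  have Q: "q \<in> Qset n \<longleftrightarrow> (\<exists>u. coprime u (int n) \<and> q = u\<^sup>2 mod int n)" for q
  proof
    assume "\<exists>u. coprime u (int n) \<and> q = u\<^sup>2 mod int n"
    then obtain u where u: "coprime u (int n)" "q = u\<^sup>2 mod int n" by blast
    have "u mod int n \<in> Zmod_units n"
      using u(1) assms unfolding units Zmod_def by (simp add: coprime_commute)
    moreover have "q = (u mod int n)\<^sup>2 mod int n" using u(2) by (simp add: power_mod)
    ultimately show "q \<in> Qset n" unfolding Qset_def by blast
  qed (auto simp: Qset_def units)
  have "t \<in> Tset n \<longleftrightarrow> (\<exists>u. coprime u (int n) \<and> t = u\<^sup>2 mod int n) \<or>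
      (\<exists>u. coprime u (int n) \<and> t = (- u\<^sup>2) mod int n)"
    unfolding Tset_def Un_iff image_iff Bex_def Q by (auto simp: mod_minus_eq)
  then show ?thesis by auto
qed

lemma quad_unitary_Cayley_arc_iff:
  assumes "n > 0" "a \<in> Zmod n" "b \<in> Zmod n"
  shows "(a, b) \<in> arcs (quad_unitary_Cayley n) \<longleftrightarrow>
    (\<exists>s \<in> {1, -1}. \<exists>u. coprime u (int n) \<and> [a - b = s * u\<^sup>2] (mod int n))"
  unfolding cong_def using assms(2,3) Tset_iff[OF assms(1), of "(a - b) mod int n"]
  by (simp add: quad_unitary_Cayley_def Cay_def)

interpretation quad_unitary_Cayley: pseudo_graph "quad_unitary_Cayley n" for n
  by (rule pseudo_graph_quad_unitary_Cayley)

lemma quad_unitary_Cayley_simps [simp]: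
  "verts (quad_unitary_Cayley n) = Zmod n"
  "tail (quad_unitary_Cayley n) = fst" "head (quad_unitary_Cayley n) = snd"
  by (simp_all add: quad_unitary_Cayley_def Cay_def)

lemma awalk_of_unit_square_sum:
  assumes "n > 0" "a \<in> Zmod n" "b \<in> Zmod n" "set ss \<subseteq> {1, -1}"
    and "unit_square_sum ss (int n) (a - b)"
  shows "\<exists>p. pre_digraph.awalk (quad_unitary_Cayley n) a p b \<and> length p = length ss"
  using assms(2,4,5)
proof (induction ss arbitrary: a)
  case Nil
  then have "a = b" using assms(3) by (auto simp: Zmod_def cong_iff_dvd_diff cong_less_imp_eq_int)
  then show ?case using assms(3) by (intro exI[of _ "[]"]) (simp add: quad_unitary_Cayley.awalk_Nil_iff)
next
  case (Cons s ss)
  then obtain u where u: "coprime u (int n)" "unit_square_sum ss (int n) (a - b - s * u\<^sup>2)" by auto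
  define c where "c = (a - s * u\<^sup>2) mod int n"
  have c: "c \<in> Zmod n" using assms(1) by (simp add: c_def Zmod_def)
  have cc: "[c = a - s * u\<^sup>2] (mod int n)" by (simp add: c_def)
  have "[c - b = a - s * u\<^sup>2 - b] (mod int n)" by (intro cong_diff cc cong_refl)
  then have "unit_square_sum ss (int n) (c - b)"
    using u(2) unit_square_sum_cong[of "c - b"] by (simp add: algebra_simps)
  then obtain p where p: "pre_digraph.awalk (quad_unitary_Cayley n) c p b" "length p = length ss"
    using Cons.IH c Cons.prems by auto
  have "[a - c = a - (a - s * u\<^sup>2)] (mod int n)" by (intro cong_diff cc cong_refl)
  then have "(a, c) \<in> arcs (quad_unitary_Cayley n)"
    using quad_unitary_Cayley_arc_iff[OF assms(1) Cons.prems(1) c] u(1) Cons.prems(2) by auto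
  then have "pre_digraph.awalk (quad_unitary_Cayley n) a ((a, c) # p) b"
    using p(1) by (simp add: quad_unitary_Cayley.awalk_Cons_iff)
  then show ?case using p(2) by (metis length_Cons)
qed

lemma unit_square_sum_of_awalk:
  assumes "n > 0" "pre_digraph.awalk (quad_unitary_Cayley n) a p b"
  shows "\<exists>ss. set ss \<subseteq> {1, -1} \<and> length ss = length p \<and> unit_square_sum ss (int n) (a - b)"
  using assms(2)
proof (induction p arbitrary: a)
  case Nil
  then show ?case by (simp add: quad_unitary_Cayley.awalk_Nil_iff)
next
  case (Cons e p)
  obtain c where e: "e = (a, c)" "(a, c) \<in> arcs (quad_unitary_Cayley n)"
    and p: "pre_digraph.awalk (quad_unitary_Cayley n) c p b"
    using Cons.prems by (cases e) (auto simp: quad_unitary_Cayley.awalk_Cons_iff)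
  have "a \<in> Zmod n" "c \<in> Zmod n" using e(2) by (auto simp: quad_unitary_Cayley_def Cay_def)
  then obtain s u where su: "s \<in> {1, -1}" "coprime u (int n)" "[a - c = s * u\<^sup>2] (mod int n)"
    using e(2) quad_unitary_Cayley_arc_iff[OF assms(1)] by blast
  obtain ss where ss: "set ss \<subseteq> {1, -1}" "length ss = length p" "unit_square_sum ss (int n) (c - b)"
    using Cons.IH[OF p] by blast
  have "[c - b = a - b - s * u\<^sup>2] (mod int n)"
    using su(3) by (simp add: cong_iff_dvd_diff dvd_diff_commute algebra_simps)
  then have "unit_square_sum (s # ss) (int n) (a - b)" 
    using ss(3) su(2) unit_square_sum_cong by (metis unit_square_sum.simps(2))
  then show ?case using su(1) ss by (intro exI[of _ "s # ss"]) auto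
qed

lemma awalk_cost_1: "wf_digraph.awalk_cost (\<lambda>_. 1) (p :: (int \<times> int) list) = real (length p)"
  by (induction p) auto

lemma diameter_quad_unitary_Cayley_le:
  assumes "n > 0"
    and "\<And>x. \<exists>ss. set ss \<subseteq> {1, -1} \<and> length ss \<le> D \<and> unit_square_sum ss (int n) x"
  shows "diameter (quad_unitary_Cayley n) \<le> ereal (real D)"
  unfolding diameter_def
proof (intro SUP_least)
  fix a b assume "a \<in> verts (quad_unitary_Cayley n)" "b \<in> verts (quad_unitary_Cayley n)"
  moreover obtain ss where "set ss \<subseteq> {1, -1}" "length ss \<le> D" "unit_square_sum ss (int n) (a - b)"
    using assms(2) by blast
  ultimately obtain p where "pre_digraph.awalk (quad_unitary_Cayley n) a p b" "length p \<le> D"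
    using awalk_of_unit_square_sum[OF assms(1)] by force
  then show "wf_digraph.\<mu> (quad_unitary_Cayley n) (\<lambda>_. 1) a b \<le> ereal (real D)"
    using quad_unitary_Cayley.min_cost_le_walk_cost[of n a p b "\<lambda>_. 1"]
    by (auto simp: awalk_cost_1 elim: order_trans)
qed

text \<open>One hard residue \<open>x\<close> suffices: every walk from \<open>x mod int n\<close>
  to 0 represents it. The distance is an infimum over walks, so the case of no walk at all is
  covered.\<close>

lemma diameter_quad_unitary_Cayley_ge:
  assumes "n > 0"
    and "\<And>ss. set ss \<subseteq> {1, -1} \<Longrightarrow> unit_square_sum ss (int n) x \<Longrightarrow> length ss \<ge> D"
  shows "diameter (quad_unitary_Cayley n) \<ge> ereal (real D)"
proof -
  have D: "length p \<ge> D" if walk: "pre_digraph.awalk (quad_unitary_Cayley n) (x mod int n) p 0" for p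
  proof -
    obtain ss where ss: "set ss \<subseteq> {1, -1}" "length ss = length p"
      "unit_square_sum ss (int n) (x mod int n)"
      using unit_square_sum_of_awalk[OF assms(1) walk] by auto
    then have "unit_square_sum ss (int n) x" 
      using unit_square_sum_cong[of "x mod int n" x "int n" ss] by simp
    then show ?thesis using assms(2) ss by metis
  qed
  have "ereal (real D) \<le> wf_digraph.\<mu> (quad_unitary_Cayley n) (\<lambda>_. 1) (x mod int n) 0"
    unfolding quad_unitary_Cayley.\<mu>_def by (intro INF_greatest) (simp add: awalk_cost_1 D)
  also have "\<dots> \<le> diameter (quad_unitary_Cayley n)"
    unfolding diameter_def by (intro SUP_upper2[of "x mod int n"] SUP_upper2[of 0])
      (use assms(1) in \<open>auto simp: Zmod_def\<close>)
  finally show ?thesis .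
qed

section \<open>Upper bounds\<close>

text \<open>The primes 2 and 3 only constrain the sum of the signs, through
  \<open>gcd (int n) 24\<close>; the prime 5 asks for four terms, and larger primes ask for three or
  for a separate argument.\<close>

lemma unit_square_sum_local_global:
  assumes n: "n > 0" and ss: "ss \<noteq> []" "set ss \<subseteq> {1, -1}"
    and sum: "[x = sum_list ss] (mod gcd (int n) 24)"
    and five: "5 dvd n \<Longrightarrow> length ss \<ge> 4"
    and large: "\<And>p. prime p \<Longrightarrow> p > 5 \<Longrightarrow> p dvd n \<Longrightarrow> length ss \<ge> 3 \<or> unit_square_sum ss (int p) x"
  shows "unit_square_sum ss (int n) x"
  using n
proof (rule unit_square_sum_prime_powers)
  fix p k :: nat assume pk: "prime p" "k > 0" "p ^ k dvd n"
  have "p dvd n" using pk dvd_power dvd_trans by blast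
  have small: "p \<in> {2, 3, 5}" if "p \<le> 5"
  proof -
    have "p \<noteq> 4" using prime_odd_nat[OF pk(1)] by auto
    then show ?thesis using that prime_ge_2_nat[OF pk(1)] by auto
  qed
  have dvd: "int p ^ k dvd int n" using pk(3) by (metis int_dvd_int_iff of_nat_power)
  consider "p = 2" | "p = 3" | "p = 5" | "p > 5" using small by fastforce
  then show "unit_square_sum ss (int p ^ k) x"
  proof cases
    case 1
    have "gcd (int n) 8 dvd gcd (int n) 24" by (intro gcd_mono) auto
    moreover have "gcd 8 (2 ^ k) dvd gcd (int n) 8" using dvd 1 by (auto intro: dvd_trans)
    ultimately have "gcd 8 (2 ^ k) dvd gcd (int n) 24" by (rule dvd_trans[rotated])
    then show ?thesis 
      using unit_square_sum_two_power[OF ss] cong_dvd_modulus[OF sum] 1 by simp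
  next
    case 2
    then have "3 dvd gcd (int n) 24" using \<open>p dvd n\<close> by auto
    then show ?thesis
      using unit_square_sum_3_power[OF ss _ pk(2)] cong_dvd_modulus[OF sum] 2 by simp
  next
    case 3
    then have "unit_square_sum ss 5 x" using unit_square_sum_5 five ss \<open>p dvd n\<close> by simp
    then show ?thesis 
      using unit_square_sum_lift_odd_prime_power[OF pk(1) _ ss] 3 pk(2) by simp
  next
    case 4
    then have "unit_square_sum ss (int p) x" 
      using large[OF pk(1) 4 \<open>p dvd n\<close>] unit_square_sum_prime_ge_7[OF pk(1) 4] ss by blast
    then show ?thesis 
      using unit_square_sum_lift_odd_prime_power[OF pk(1) _ ss] 4 pk(2) by simp
  qed
qed

lemma sign_list_exists:
  assumes "\<bar>r\<bar> \<le> int k" "even (r - int k)"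
  shows "\<exists>ss. set ss \<subseteq> {1, -1} \<and> length ss = k \<and> sum_list ss = r"
proof -
  obtain c where c: "r - int k = 2 * c" using assms(2) by (elim evenE)
  \<comment> \<open>\<open>a\<close> plus signs and \<open>b\<close> minus signs, from a + b = k and
    a - b = r.\<close>
  define a b where "a = nat (int k + c)" and "b = nat (- c)"
  have "int a + int b = int k" "int a - int b = r" 
    using assms(1) c unfolding a_def b_def by auto
  moreover have "sum_list (replicate k c) = int k * c" for k c by (induction k) (auto simp: algebra_simps)
  ultimately show ?thesis
    by (intro exI[of _ "replicate a 1 @ replicate b (-1)"]) (auto simp: set_replicate_conv_if)
qed

lemma least_absolute_residue:
  assumes "m > 0"
  shows "\<exists>r. [x = r] (mod m) \<and> 2 * \<bar>r\<bar> \<le> (m::int)"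
proof (cases "2 * (x mod m) \<le> m")
  case True
  then show ?thesis using assms by (intro exI[of _ "x mod m"]) auto
next
  case False
  have "x mod m < m" using assms by simp
  then show ?thesis using False by (intro exI[of _ "x mod m - m"]) (auto simp: cong_def mod_diff_right_eq)
qed

definition sum_within :: "nat \<Rightarrow> nat \<Rightarrow> int \<Rightarrow> bool" where
  "sum_within n D x \<longleftrightarrow> (\<exists>ss. set ss \<subseteq> {1, -1} \<and> length ss \<le> D \<and> unit_square_sum ss (int n) x)"

lemma sum_within_residue:
  assumes "n > 0" "k \<ge> 3" "5 dvd n \<Longrightarrow> k \<ge> 4"
    and "\<bar>r\<bar> \<le> int k" "even (r - int k)" "[x = r] (mod gcd (int n) 24)" "k \<le> D"
  shows "sum_within n D x"
proof -
  obtain ss where ss: "set ss \<subseteq> {1, -1}" "length ss = k" "sum_list ss = r"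
    using sign_list_exists assms by blast
  then have "unit_square_sum ss (int n) x"
    using assms by (intro unit_square_sum_local_global) auto
  then show ?thesis using ss \<open>k \<le> D\<close> unfolding sum_within_def by auto
qed

text \<open>The least absolute residue \<open>r\<close> is at most \<open>D\<close>. If its parity
  differs from that of \<open>D\<close>, then it is at most \<open>D - 1\<close>, and
  \<open>D - 1\<close> terms are used; the bounds 4 and 5 on \<open>D\<close> keep even that shorter
  list long enough for the odd primes.\<close>

lemma sum_within_ge_4:
  assumes "n > 0" "D \<ge> 4" "5 dvd n \<Longrightarrow> D \<ge> 5" "gcd n 24 \<le> 2 * D"
  shows "sum_within n D x"
proof -
  have "gcd (int n) 24 = int (gcd n 24)" by (metis gcd_int_int_eq of_nat_numeral)
  then obtain r where r: "[x = r] (mod gcd (int n) 24)" "2 * \<bar>r\<bar> \<le> int (gcd n 24)"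
    using least_absolute_residue[of "gcd (int n) 24" x] by auto
  then have rD: "\<bar>r\<bar> \<le> int D" using assms(4) by linarith
  show ?thesis
  proof (cases "even (r - int D)")
    case True
    then show ?thesis using assms rD r by (intro sum_within_residue[of n D r]) auto
  next
    case False
    then have "r \<noteq> int D" "r \<noteq> - int D" by auto
    then have "\<bar>r\<bar> \<noteq> int D" by linarith
    then show ?thesis using assms rD r False 
      by (intro sum_within_residue[of n "D - 1" r]) (auto simp: of_nat_diff)
  qed
qed

text \<open>For \<open>p\<close> other than 5 the gcd with 24 is at most 8, so
  \<open>sum_within_ge_4\<close> applies. For powers of 5 that gcd is 1, so the sum of the signs may
  always be 0 and exactly four terms do.\<close>

lemma sum_within_prime_power:
  assumes "prime p"
  shows "sum_within (p ^ m) 4 x"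
proof (cases "p = 5")
  case True
  have "coprime 5 (24::int)" by (simp add: coprime_iff_gcd_eq_1 gcd_non_0_int)
  then have "coprime (5 ^ m) (24::int)" by simp
  then show ?thesis using True by (intro sum_within_residue[of _ 4 0]) auto
next
  case False
  have prime5: "prime (5::nat)" by simp
  have "\<not> 5 dvd p ^ m"
    using False primes_dvd_imp_eq[OF prime5 assms] prime_dvd_power[OF prime5] by blast
  moreover have "gcd (p ^ m) 24 \<le> 8"
  proof (cases "p \<in> {2, 3}")
    case True
    define g where "g = gcd (p ^ m) 24"
    have "g dvd p ^ m" "g dvd 24" unfolding g_def by (rule gcd_dvd1, rule gcd_dvd2)
    then have "g dvd 8 * 3" by simp
    have "coprime (2 ^ m) (3 :: nat)" by simp
    moreover have "coprime 3 (2 ^ 3 :: nat)" unfolding coprime_power_right_iff by simp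
    then have "coprime (3 ^ m) (8 :: nat)" by simp
    ultimately have "coprime (p ^ m) 3 \<or> coprime (p ^ m) 8" using True by blast
    then have "coprime g 3 \<or> coprime g 8"
      using coprime_divisors[OF \<open>g dvd p ^ m\<close> dvd_refl] by blast
    then have "g dvd 8 \<or> g dvd 3"
      using \<open>g dvd 8 * 3\<close> coprime_dvd_mult_left_iff[of g 3 8] coprime_dvd_mult_right_iff[of g 8 3] by blast
    then show ?thesis using dvd_imp_le[of g 8] dvd_imp_le[of g 3] unfolding g_def by fastforce
  next
    case False
    have "prime (3::nat)" by simp
    then have "coprime p 2" "coprime p 3"
      using False primes_coprime[OF assms two_is_prime_nat] primes_coprime[OF assms] by auto
    then have "coprime (p ^ m) (2 ^ 3 * 3)"
      by (simp only: coprime_mult_right_iff coprime_power_left_iff coprime_power_right_iff) simp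
    then have "gcd (p ^ m) (2 ^ 3 * 3) = 1" by (rule coprime_imp_gcd_eq_1)
    then show ?thesis by simp
  qed
  ultimately show ?thesis using assms by (intro sum_within_ge_4) (auto simp: prime_gt_0_nat)
qed

text \<open>Odd residues take three terms, even ones two. Two terms are delicate only at primes p >
  5 dividing \<open>x\<close>: opposite signs give 1 - 1 = 0, while equal signs occur only if the
  gcd is not 2, and then \<open>delta3 n = 0\<close> provides a square root of -1.\<close>

lemma sum_within_3:
  assumes "n > 0" "even n" "\<not> 5 dvd n" "gcd n 24 \<le> 6" "gcd n 24 = 2 \<or> delta3 n = 0"
  shows "sum_within n 3 x"
proof -
  define g where "g = gcd (int n) 24"
  have g: "g = int (gcd n 24)" unfolding g_def by (metis gcd_int_int_eq of_nat_numeral)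
  have "even g" using assms(2) by (simp add: g_def)
  \<comment> \<open>For \<open>g = 2\<close> the least absolute residue is at most 1, so an even one
    is 0.\<close>
  obtain r where r: "[x = r] (mod g)" "\<bar>r\<bar> \<le> 3" "even r \<Longrightarrow> g = 2 \<Longrightarrow> r = 0"
  proof -
    obtain r where r: "[x = r] (mod g)" "2 * \<bar>r\<bar> \<le> g"
      using least_absolute_residue[of g x] assms(1) unfolding g_def by auto
    then have "\<bar>r\<bar> \<le> 3" using assms(4) g by linarith
    moreover have "r = 0" if "even r" "g = 2" using that r(2) by (auto elim!: evenE)
    ultimately show ?thesis using that r(1) by blast
  qed
  show ?thesis
  proof (cases "even r")
    case False
    then show ?thesis using r assms by (intro sum_within_residue[of n 3 r]) (auto simp: g_def)
  next
    case True
    then have "\<bar>r\<bar> \<le> 2" 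
    proof -
      have "r \<noteq> 3" "r \<noteq> - 3" using True by auto
      then show ?thesis using r(2) by linarith
    qed
    then obtain ss where ss: "set ss \<subseteq> {1, -1}" "length ss = 2" "sum_list ss = r"
      using sign_list_exists[of r 2] True by auto
    then obtain s t where st: "ss = [s, t]" "s \<in> {1, -1}" "t \<in> {1, -1}"
      by (cases ss; cases "tl ss"; cases "tl (tl ss)") auto
    have "unit_square_sum [s, t] (int p) x" if p: "prime p" "p > 5" "p dvd n" for p
    proof (cases "int p dvd x")
      case False
      then show ?thesis using unit_square_sum_pair_prime p st by blast
    next
      case True
      then have x: "[x = 0] (mod int p)" by (simp add: cong_0_iff)
      show ?thesis
      proof (cases "s = t")
        case False
        then have "s * 1\<^sup>2 + t * 1\<^sup>2 = 0" using st by auto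
        then show ?thesis using x unfolding unit_square_sum_pair by (metis coprime_1_left)
      next
        case eq: True
        then have "g \<noteq> 2" using r(3) \<open>even r\<close> ss st by auto
        then have "delta3 n = 0" using assms(5) g by auto
        then have "\<not> [p = 3] (mod 4)" using p by (auto simp: delta3_def split: if_splits)
        moreover have "odd p" using p prime_odd_nat by auto
        ultimately have "[p = 1] (mod 4)" unfolding cong_def by simp presburger
        then obtain i where i: "[i\<^sup>2 = - 1] (mod int p)"
          using minus_one_square_mod_prime p(1) by blast
        then have "coprime (i\<^sup>2) (int p)" by (metis cong_imp_coprime cong_sym coprime_1_left coprime_minus_left_iff)
        then have "coprime i (int p)" by simp
        moreover have "[s * 1\<^sup>2 + s * i\<^sup>2 = s * 1\<^sup>2 + s * (- 1)] (mod int p)"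
          by (intro cong_add cong_mult cong_refl i)
        then have "[x = s * 1\<^sup>2 + t * i\<^sup>2] (mod int p)" using x eq
          by (metis add.right_inverse cong_sym cong_trans mult.right_neutral mult_minus1_right power_one)
        ultimately show ?thesis unfolding unit_square_sum_pair using coprime_1_left by blast
      qed
    qed
    then have "unit_square_sum ss (int n) x"
      using ss st r assms by (intro unit_square_sum_local_global) (auto simp: g_def)
    then show ?thesis using ss unfolding sum_within_def by force
  qed
qed

text \<open>All units are 1 and all signs are equal. This serves the moduli 2 and 4, whose diameters
  are below 3.\<close>

lemma sum_within_half_modulus:
  assumes "n > 0"
  shows "sum_within n (n div 2) x"
proof -
  obtain r where r: "[x = r] (mod int n)" "2 * \<bar>r\<bar> \<le> int n"
    using least_absolute_residue[of "int n" x] assms by auto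
  have "even (r - int (nat \<bar>r\<bar>))" by (simp add: abs_if)
  then obtain ss where ss: "set ss \<subseteq> {1, -1}" "length ss = nat \<bar>r\<bar>" "sum_list ss = r"
    using sign_list_exists[of r "nat \<bar>r\<bar>"] by auto
  then have "unit_square_sum ss (int n) x"
    using unit_square_sum_cong[OF r(1)] unit_square_sum_sum_list by metis
  then show ?thesis using ss r(2) unfolding sum_within_def by (intro exI[of _ ss]) auto
qed

section \<open>Lower bounds\<close>

text \<open>Unit groups modulo divisors of 24 have exponent at most 2, and modulo 10 the unit
  squares are 1 and 9. A finite evaluation over all residues confirms both.\<close>

lemma unit_square_mod_small:
  fixes m u :: int
  assumes "m \<in> {2, 4, 6, 8, 10, 12, 24}" "coprime u m"
  shows "[u\<^sup>2 = 1] (mod m) \<or> (m = 10 \<and> [u\<^sup>2 = - 1] (mod m))"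
proof -
  have "m > 0" using assms(1) by auto
  have "\<forall>m \<in> set [2, 4, 6, 8, 10, 12, 24::int]. \<forall>v \<in> set [0..m - 1]. gcd v m = 1 \<longrightarrow>
     v\<^sup>2 mod m = 1 mod m \<or> m = 10 \<and> v\<^sup>2 mod m = (- 1) mod m"
    by code_simp
  moreover have "m \<in> set [2, 4, 6, 8, 10, 12, 24::int]" using assms(1) by simp
  moreover have "u mod m \<in> set [0..m - 1]" using \<open>m > 0\<close> by simp
  moreover have "gcd (u mod m) m = 1" using assms(2) by (metis coprime_iff_gcd_eq_1 gcd.commute gcd_red_int)
  ultimately show ?thesis unfolding cong_def by (metis power_mod)
qed

text \<open>Each term is 1 or -1 modulo \<open>m\<close>, so it moves the residue by at most one
  step.\<close>

lemma unit_square_sum_small_residue: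
  assumes "m \<in> {2, 4, 6, 8, 10, 12, 24}" "set ss \<subseteq> {1, -1}" "unit_square_sum ss m x"
  shows "\<exists>r. \<bar>r\<bar> \<le> int (length ss) \<and> [x = r] (mod m)"
  using assms(2,3)
proof (induction ss arbitrary: x)
  case Nil
  then show ?case by auto
next
  case (Cons s ss)
  then obtain u where u: "coprime u m" "unit_square_sum ss m (x - s * u\<^sup>2)" by auto
  obtain r where r: "\<bar>r\<bar> \<le> int (length ss)" "[x - s * u\<^sup>2 = r] (mod m)"
    using Cons.IH[OF _ u(2)] Cons.prems by auto
  obtain e :: int where e: "\<bar>e\<bar> = 1" "[u\<^sup>2 = e] (mod m)"
    using unit_square_mod_small[OF assms(1) u(1)] by (metis abs_1 abs_minus)
  have "[(x - s * u\<^sup>2) + s * u\<^sup>2 = r + s * e] (mod m)" by (intro cong_add cong_mult cong_refl r e)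
  moreover have "\<bar>r + s * e\<bar> \<le> int (length (s # ss))"
    using r(1) e(1) Cons.prems(1) by (auto simp: abs_if split: if_splits)
  ultimately show ?case by auto
qed

text \<open>The residue \<open>m div 2\<close> is farthest from 0: its representatives are the odd
  multiples of \<open>m div 2\<close>.\<close>

lemma unit_square_sum_length_ge_half:
  assumes "m \<in> {2, 4, 6, 8, 10, 12, 24}" "m dvd int n" 
    and "set ss \<subseteq> {1, -1}" "unit_square_sum ss (int n) (m div 2)"
  shows "m div 2 \<le> int (length ss)"
proof -
  obtain r where r: "\<bar>r\<bar> \<le> int (length ss)" "[m div 2 = r] (mod m)"
    using unit_square_sum_small_residue[OF assms(1,3) unit_square_sum_dvd_modulus[OF assms(4,2)]]
    by blast
  then obtain c where c: "r = m div 2 + m * c" by (metis cong_iff_lin)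
  have m: "m = 2 * (m div 2)" "m div 2 > 0" using assms(1) by auto
  have "r = m div 2 * (1 + 2 * c)" unfolding c by (subst (2) m(1)) (simp add: algebra_simps)
  then have "\<bar>r\<bar> = m div 2 * \<bar>1 + 2 * c\<bar>" using m(2) by (simp add: abs_mult)
  moreover have "\<bar>1 + 2 * c\<bar> \<ge> 1" by presburger
  ultimately have "m div 2 \<le> \<bar>r\<bar>" using m(2) by simp
  then show ?thesis using r(1) by linarith
qed

lemma unit_square_sum_parity:
  assumes "even n" "set ss \<subseteq> {1, -1}" "unit_square_sum ss (int n) x"
  shows "even (x - int (length ss))"
proof -
  have "unit_square_sum ss 2 x" using unit_square_sum_dvd_modulus assms by auto
  then show ?thesis using assms(2)
  proof (induction ss arbitrary: x)
    case Nil
    then show ?case by (simp add: cong_0_iff)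
  next
    case (Cons s ss)
    then obtain u where u: "odd u" "unit_square_sum ss 2 (x - s * u\<^sup>2)" by auto
    have "even (x - s * u\<^sup>2 - int (length ss))" using Cons.IH[OF u(2)] Cons.prems(2) by simp
    moreover have "odd s" using Cons.prems(2) by auto
    ultimately show ?case using u(1) by auto
  qed
qed

text \<open>Parity leaves length 1 or at least 3, and a single term is a unit modulo
  \<open>p\<close> whereas \<open>x\<close> is not.\<close>

lemma unit_square_sum_length_ge_3:
  assumes "even n" "prime p" "p dvd n" "int p dvd x" "odd x"
    and "set ss \<subseteq> {1, -1}" "unit_square_sum ss (int n) x"
  shows "length ss \<ge> 3"
proof (rule ccontr)
  assume "\<not> length ss \<ge> 3"
  moreover have "odd (length ss)" using unit_square_sum_parity[OF assms(1,6,7)] assms(5) by auto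
  ultimately have "length ss = 1" by (auto elim!: oddE)
  then obtain s where s: "ss = [s]" by (cases ss) auto
  have "unit_square_sum [s] (int p) x" 
    using unit_square_sum_dvd_modulus[OF assms(7)[unfolded s], of "int p"] assms(3) 
    by (simp del: unit_square_sum.simps)
  then obtain u where u: "coprime u (int p)" "[x = s * u\<^sup>2] (mod int p)" 
    by (auto simp: cong_diff_iff_cong_0)
  then have "int p dvd s * u\<^sup>2" using assms(4) cong_dvd_iff by blast
  moreover have "s \<in> {1, -1}" using assms(6) s by auto
  ultimately have "int p dvd u" using assms(2) by (auto simp: prime_dvd_power_iff)
  then show False using u(1) coprime_int_prime_iff[OF assms(2)] by blast
qed

text \<open>Parity leaves lengths 0 and 2 to exclude. Length 0 and two opposite signs both give 0
  modulo \<open>m\<close>, which does not divide 2p; two equal signs make \<open>p\<close> divide a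
  sum of two unit squares.\<close>

lemma unit_square_sum_length_ge_4:
  assumes "m \<in> {4, 6}" "m dvd int n" "prime p" "p dvd n" "p > 3" "[p = 3] (mod 4)"
    and "set ss \<subseteq> {1, -1}" "unit_square_sum ss (int n) (2 * int p)"
  shows "length ss \<ge> 4"
proof (rule ccontr)
  assume small: "\<not> length ss \<ge> 4"
  have "2 dvd m" using assms(1) by auto
  then have "even n" using dvd_trans[OF _ assms(2), of 2] by simp
  have nd: "\<not> m dvd 2 * int p"
  proof
    assume "m dvd 2 * int p"
    then have "2 dvd int p \<or> 3 dvd int p" using assms(1) by (auto elim!: dvdE; presburger)
    then have "2 dvd p \<or> 3 dvd p" by presburger
    then show False using assms(3,5) primes_dvd_imp_eq[of 2 p] primes_dvd_imp_eq[of 3 p] by auto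
  qed
  have m: "unit_square_sum ss m (2 * int p)" using unit_square_sum_dvd_modulus assms by blast
  have "even (length ss)" using unit_square_sum_parity[OF \<open>even n\<close> assms(7,8)] by auto
  then have "length ss = 0 \<or> length ss = 2" using small by presburger
  moreover have "length ss \<noteq> 0" using m nd by (auto simp: cong_0_iff)
  ultimately obtain s t where st: "ss = [s, t]" "s \<in> {1, -1}" "t \<in> {1, -1}"
    using assms(7) by (cases ss; cases "tl ss"; cases "tl (tl ss)") auto
  show False
  proof (cases "s = t")
    case True
    have "unit_square_sum [s, s] (int p) (2 * int p)" 
      using unit_square_sum_dvd_modulus[OF assms(8), of "int p"] assms(4) st(1) True
      by (simp del: unit_square_sum.simps)
    then obtain u v where uv: "coprime v (int p)" "[2 * int p = s * u\<^sup>2 + s * v\<^sup>2] (mod int p)"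
      unfolding unit_square_sum_pair by blast
    then have "int p dvd s * u\<^sup>2 + s * v\<^sup>2" using cong_dvd_iff by (metis dvd_triv_right)
    then have "int p dvd u\<^sup>2 + v\<^sup>2" using st(2) by (auto simp: dvd_diff_commute algebra_simps)
    then show False using sum_two_squares_prime_3_mod_4[OF assms(3,6)] uv(1) 
        coprime_int_prime_iff[OF assms(3)] by blast
  next
    case False
    obtain u v where uv: "coprime u m" "coprime v m" "[2 * int p = s * u\<^sup>2 + t * v\<^sup>2] (mod m)"
      using m unfolding st unit_square_sum_pair by blast
    have sq: "[u\<^sup>2 = 1] (mod m)" "[v\<^sup>2 = 1] (mod m)"
      using unit_square_mod_small[of m] assms(1) uv(1,2) by auto
    have "[s * u\<^sup>2 + t * v\<^sup>2 = s * 1 + t * 1] (mod m)" 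
      by (intro cong_add cong_mult cong_refl sq)
    then have "[2 * int p = 0] (mod m)" using uv(3) False st by (auto dest: cong_trans)
    then show False using nd by (simp add: cong_0_iff)
  qed
qed

section \<open>The diameter in each case\<close>

lemma diameter_le_sum_within:
  assumes "n > 0" "\<And>x. sum_within n D x"
  shows "diameter (quad_unitary_Cayley n) \<le> ereal (real D)"
  using assms unfolding sum_within_def by (rule diameter_quad_unitary_Cayley_le)

lemma diameter_ge_half_divisor:
  assumes "n > 0" "m \<in> {2, 4, 6, 8, 10, 12, 24}" "m dvd n"
  shows "diameter (quad_unitary_Cayley n) \<ge> ereal (real (m div 2))"
proof (rule diameter_quad_unitary_Cayley_ge[OF assms(1)])
  fix ss :: "int list" assume "set ss \<subseteq> {1, -1}" "unit_square_sum ss (int n) (int m div 2)"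
  moreover have "int m \<in> {2, 4, 6, 8, 10, 12, 24}" "int m dvd int n" using assms by auto
  ultimately have "int m div 2 \<le> int (length ss)" 
    using unit_square_sum_length_ge_half by blast
  then show "m div 2 \<le> length ss" by linarith
qed

lemma not_dvd_of_coprime:
  fixes K c q :: nat
  assumes "coprime K c" "q dvd c" "q \<noteq> 1"
  shows "\<not> q dvd K"
  using assms by (metis coprime_common_divisor_nat nat_dvd_1_iff_1)

lemma gcd_24_cases: "gcd n 24 \<in> {1, 2, 3, 4, 6, 8, 12, 24 :: nat}"
proof -
  define g where "g = gcd n 24"
  have "g dvd 24" by (simp add: g_def)
  then have "g \<le> 24" by (simp add: dvd_imp_le)
  then have "g \<in> set [0..<25]" by simp
  moreover have "\<forall>g \<in> set [0..<25]. g dvd 24 \<longrightarrow> g \<in> {1, 2, 3, 4, 6, 8, 12, 24 :: nat}" by code_simp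
  ultimately show ?thesis using \<open>g dvd 24\<close> unfolding g_def by blast
qed

lemma gcd_24_le:
  fixes n :: nat
  shows "\<not> 24 dvd n \<Longrightarrow> gcd n 24 \<le> 12" "\<not> 12 dvd n \<Longrightarrow> gcd n 24 \<le> 8"
    "\<not> 3 dvd n \<Longrightarrow> gcd n 24 \<le> 8" "\<not> 4 dvd n \<Longrightarrow> gcd n 24 \<le> 6" 
    "\<not> 8 dvd n \<Longrightarrow> \<not> 3 dvd n \<Longrightarrow> gcd n 24 \<le> 4"
    "\<not> 4 dvd n \<Longrightarrow> \<not> 3 dvd n \<Longrightarrow> even n \<Longrightarrow> gcd n 24 = 2"
proof -
  define g where "g = gcd n 24"
  have "g dvd n" "even n \<Longrightarrow> even g" by (simp_all add: g_def)
  then have dvd: "\<And>d. d dvd g \<Longrightarrow> d dvd n" using dvd_trans by blast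
  have g: "g \<in> {1, 2, 3, 4, 6, 8, 12, 24}" unfolding g_def by (rule gcd_24_cases)
  note facts = g dvd[of 24] dvd[of 12] dvd[of 3] dvd[of 4] dvd[of 8] \<open>even n \<Longrightarrow> even g\<close>
  show "\<not> 24 dvd n \<Longrightarrow> gcd n 24 \<le> 12" "\<not> 12 dvd n \<Longrightarrow> gcd n 24 \<le> 8"
    "\<not> 3 dvd n \<Longrightarrow> gcd n 24 \<le> 8" "\<not> 4 dvd n \<Longrightarrow> gcd n 24 \<le> 6" 
    "\<not> 8 dvd n \<Longrightarrow> \<not> 3 dvd n \<Longrightarrow> gcd n 24 \<le> 4"
    "\<not> 4 dvd n \<Longrightarrow> \<not> 3 dvd n \<Longrightarrow> even n \<Longrightarrow> gcd n 24 = 2"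
    unfolding g_def[symmetric] using facts by auto
qed

text \<open>The hard residue is \<open>K\<close> itself, odd and divisible by a prime of
  \<open>n\<close>.\<close>

lemma diameter_ge_3:
  assumes "even n" "n > 0" "odd K" "K > 1" "K dvd n"
  shows "diameter (quad_unitary_Cayley n) \<ge> 3"
proof -
  obtain p where p: "prime p" "p dvd K" using prime_factor_nat[of K] assms(4) by auto
  have "ereal (real 3) \<le> diameter (quad_unitary_Cayley n)"
  proof (rule diameter_quad_unitary_Cayley_ge[OF assms(2)])
    fix ss :: "int list" assume "set ss \<subseteq> {1, -1}" "unit_square_sum ss (int n) (int K)"
    then show "3 \<le> length ss"
      using unit_square_sum_length_ge_3[OF assms(1) p(1), of "int K" ss] p(2) assms(3,5)
      by (auto intro: dvd_trans)
  qed
  then show ?thesis by (simp add: numeral_eq_ereal)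
qed

text \<open>Common to the families 4K and 6K, where \<open>m\<close> is the modulus that rules out
  opposite signs for 2p. The lower bound 3 is a hypothesis because its source differs: a prime
  factor of K for 4K, the residue 3 modulo 6 for 6K.\<close>

lemma diameter_eq_3_plus_delta3:
  assumes n: "n > 0" "\<not> 5 dvd n" "gcd n 24 \<le> 6" and m: "m \<in> {4, 6}" "m dvd n"
    and ge3: "diameter (quad_unitary_Cayley n) \<ge> 3"
  shows "diameter (quad_unitary_Cayley n) = ereal (real (3 + delta3 n))"
proof (cases "delta3 n = 0")
  case True
  have "2 dvd m" using m(1) by auto
  then have "even n" using m(2) by (rule dvd_trans)
  then have "diameter (quad_unitary_Cayley n) \<le> ereal (real 3)"
    using n True by (intro diameter_le_sum_within sum_within_3) auto
  then show ?thesis using ge3 True by (simp add: numeral_eq_ereal antisym)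
next
  case False
  then have d: "delta3 n = 1" unfolding delta3_def by metis
  obtain p where p: "prime p" "p dvd n" "p > 3" "[p = 3] (mod 4)"
    using False unfolding delta3_def by (metis (full_types))
  have "ereal (real 4) \<le> diameter (quad_unitary_Cayley n)"
  proof (rule diameter_quad_unitary_Cayley_ge[OF n(1)])
    fix ss :: "int list" assume "set ss \<subseteq> {1, -1}" "unit_square_sum ss (int n) (2 * int p)"
    moreover have "int m \<in> {4, 6}" "int m dvd int n" using m by auto
    ultimately show "4 \<le> length ss" using unit_square_sum_length_ge_4 p by blast
  qed
  moreover have "diameter (quad_unitary_Cayley n) \<le> ereal (real 4)"
    using n by (intro diameter_le_sum_within sum_within_ge_4) auto
  ultimately show ?thesis using d by (simp add: antisym)
qed

lemma diameter_24: "n > 0 \<Longrightarrow> 24 dvd n \<Longrightarrow> diameter (quad_unitary_Cayley n) = 12"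
  using diameter_ge_half_divisor[of n 24] diameter_le_sum_within[of n 12] sum_within_ge_4[of n 12]
    gcd_le2_nat[of 24 n] by (simp add: numeral_eq_ereal antisym)

lemma diameter_12:
  assumes "odd K" "n = 12 * K"
  shows "diameter (quad_unitary_Cayley n) = 6"
proof -
  have "\<not> 24 dvd n" "12 dvd n" "n > 0" using assms by presburger+
  then show ?thesis
    using diameter_ge_half_divisor[of n 12] diameter_le_sum_within[of n 6] sum_within_ge_4[of n 6]
      gcd_24_le(1) by (simp add: numeral_eq_ereal antisym)
qed

text \<open>The residue 5 modulo 10 needs five terms. Five suffice, since without the divisor 12 the
  gcd with 24 is at most 8.\<close>

lemma diameter_10:
  assumes "n > 0" "10 dvd n" "\<not> 12 dvd n"
  shows "diameter (quad_unitary_Cayley n) = 5"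
  using assms diameter_ge_half_divisor[of n 10] diameter_le_sum_within[of n 5] sum_within_ge_4[of n 5]
    gcd_24_le(2)[of n] by (simp add: numeral_eq_ereal antisym)

lemma diameter_8:
  assumes "K > 0" "coprime K 15" "n = 8 * K"
  shows "diameter (quad_unitary_Cayley n) = 4"
proof -
  have "\<not> 3 dvd K" "\<not> 5 dvd K" using not_dvd_of_coprime[OF assms(2)] by simp_all
  then have "\<not> 3 dvd n" "\<not> 5 dvd n" "8 dvd n" "n > 0" using assms(1,3) by presburger+
  then show ?thesis
    using diameter_ge_half_divisor[of n 8] diameter_le_sum_within[of n 4] sum_within_ge_4[of n 4]
      gcd_24_le(3)[of n] by (simp add: numeral_eq_ereal antisym)
qed

lemma diameter_6:
  assumes "K > 0" "coprime K 10" "n = 6 * K"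
  shows "diameter (quad_unitary_Cayley n) = ereal (real (3 + delta3 n))"
proof -
  have "\<not> 2 dvd K" "\<not> 5 dvd K" using not_dvd_of_coprime[OF assms(2)] by simp_all
  then have n: "\<not> 4 dvd n" "\<not> 5 dvd n" "6 dvd n" "n > 0" using assms(1,3) by presburger+
  then show ?thesis
    using diameter_ge_half_divisor[of n 6] gcd_24_le(4)[of n]
    by (intro diameter_eq_3_plus_delta3[of n 6]) (simp_all add: numeral_eq_ereal)
qed

lemma diameter_4:
  assumes "K > 1" "coprime K 30" "n = 4 * K"
  shows "diameter (quad_unitary_Cayley n) = ereal (real (3 + delta3 n))"
proof -
  have K: "\<not> 2 dvd K" "\<not> 3 dvd K" "\<not> 5 dvd K" using not_dvd_of_coprime[OF assms(2)] by simp_all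
  then have n: "\<not> 8 dvd n" "\<not> 3 dvd n" "\<not> 5 dvd n" "4 dvd n" "even n" "n > 0"
    using assms(1,3) by presburger+
  have "K dvd n" using assms(3) by simp
  then have ge3: "diameter (quad_unitary_Cayley n) \<ge> 3"
    by (rule diameter_ge_3[OF n(5,6) K(1) assms(1)])
  have "gcd n 24 \<le> 6" using gcd_24_le(5)[OF n(1,2)] by linarith
  then show ?thesis
    using diameter_eq_3_plus_delta3[OF n(6,3) _ _ n(4) ge3] by blast
qed

text \<open>Here the gcd with 24 is exactly 2, so even residues use opposite signs and
  \<open>delta3\<close> does not enter.\<close>

lemma diameter_2:
  assumes "K > 1" "coprime K 30" "n = 2 * K"
  shows "diameter (quad_unitary_Cayley n) = 3"
proof -
  have K: "\<not> 2 dvd K" "\<not> 3 dvd K" "\<not> 5 dvd K" using not_dvd_of_coprime[OF assms(2)] by simp_all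
  then have n: "\<not> 4 dvd n" "\<not> 3 dvd n" "\<not> 5 dvd n" "even n" "n > 0"
    using assms(1,3) by presburger+
  then have "diameter (quad_unitary_Cayley n) \<le> ereal (real 3)"
    using gcd_24_le(6)[of n] by (intro diameter_le_sum_within sum_within_3) simp_all
  moreover have "K dvd n" using assms(3) by simp
  then have "diameter (quad_unitary_Cayley n) \<ge> 3"
    by (rule diameter_ge_3[OF n(4,5) K(1) assms(1)])
  ultimately show ?thesis by (simp add: numeral_eq_ereal antisym)
qed

lemma diameter_small:
  "diameter (quad_unitary_Cayley 4) = 2" "diameter (quad_unitary_Cayley 2) = 1"
  using diameter_ge_half_divisor[of 4 4] diameter_le_sum_within[of 4 2] sum_within_half_modulus[of 4]
    diameter_ge_half_divisor[of 2 2] diameter_le_sum_within[of 2 1] sum_within_half_modulus[of 2]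
  by (simp_all add: numeral_eq_ereal one_ereal_def antisym)

lemma diameter_le_12:
  assumes "n \<ge> 1"
  shows "diameter (quad_unitary_Cayley n) \<le> 12"
  using assms diameter_le_sum_within[of n 12] sum_within_ge_4[of n 12] gcd_le2_nat[of 24 n]
  by (simp add: numeral_eq_ereal)

lemma diameter_prime_power_le_4:
  assumes "prime p"
  shows "diameter (quad_unitary_Cayley (p ^ m)) \<le> 4"
  using diameter_le_sum_within[of "p ^ m" 4] sum_within_prime_power[OF assms] prime_gt_0_nat[OF assms]
  by (simp add: numeral_eq_ereal)

theorem theorem10:
  shows "(\<forall>n::nat. n > 0 \<longrightarrow> even n \<longrightarrow>
      (24 dvd n \<longrightarrow> diameter (quad_unitary_Cayley n) = 12) \<and>
      ((\<exists>K. odd K \<and> n = 12 * K) \<longrightarrow> diameter (quad_unitary_Cayley n) = 6) \<and>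
      (10 dvd n \<and> \<not> 12 dvd n \<longrightarrow> diameter (quad_unitary_Cayley n) = 5) \<and>
      ((\<exists>K>0. coprime K 15 \<and> n = 8 * K) \<longrightarrow> diameter (quad_unitary_Cayley n) = 4) \<and>
      ((\<exists>K>0. coprime K 10 \<and> n = 6 * K) \<longrightarrow>
         diameter (quad_unitary_Cayley n) = ereal (real (3 + delta3 n))) \<and>
      ((\<exists>K>1. coprime K 30 \<and> n = 4 * K) \<longrightarrow>
         diameter (quad_unitary_Cayley n) = ereal (real (3 + delta3 n))) \<and>
      ((\<exists>K>1. coprime K 30 \<and> n = 2 * K) \<longrightarrow> diameter (quad_unitary_Cayley n) = 3) \<and>
      (n = 4 \<longrightarrow> diameter (quad_unitary_Cayley n) = 2) \<and>
      (n = 2 \<longrightarrow> diameter (quad_unitary_Cayley n) = 1)) \<and>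
    (\<forall>n::nat. n \<ge> 1 \<longrightarrow> diameter (quad_unitary_Cayley n) \<le> 12) \<and>
    (\<forall>(p::nat) (m::nat). prime p \<longrightarrow> diameter (quad_unitary_Cayley (p ^ m)) \<le> 4)"
  by (intro conjI allI impI; (elim exE conjE)?;
      ((rule diameter_24 diameter_12 diameter_10 diameter_8 diameter_6 diameter_4 diameter_2
          diameter_le_12 diameter_prime_power_le_4; assumption) | simp only: diameter_small))

end
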